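(* Assume the Schanuel conjecture. Then: for every $b\in\overline{\mathbb{Q}}\setminus\{0,1\}$ and every nonzero value $\ln b$ of its logarithm, $\ln b\notin EL^{alg}$; in particular $\pi\notin EL^{alg}$ and $e\notin EL^{alg}$; and for every $a\in EL^{alg}\setminus\{0,1\}$, no value of $\ln a$ lies in $EL^{alg}$.
   Context: Schanuel conjecture: if $z_1,\dots,z_n\in\mathbb{C}$ are linearly independent over $\mathbb{Q}$, then at least $n$ of $z_1,\dots,z_n,e^{z_1},\dots,e^{z_n}$ are algebraically independent over $\mathbb{Q}$. For $b\in\mathbb{C}\setminus\{0,1\}$ fix a nonzero value $\ln b$ and define $b^x:=e^{x\ln b}$. For $S\subseteq\mathbb{C}$ let $b^{S}=\{b^x:x\in S\}$ and $\mathrm{Log}_b(S)=\{w: b^w\in S\}$. $\overline{F}$ is the algebraic closure in $\mathbb{C}$ of a field $F$. Define $EL_0:=\mathbb{Q}$, $EL_n:=\overline{EL_{n-1}\big(b^{EL_{n-1}},\mathrm{Log}_b(EL_{n-1})\big)}$, $EL^{(b)}:=\bigcup_{n\ge0}EL_n$; equivalently the smallest algebraically closed subfield $F\subseteq\mathbb{C}$ with $x\in F\iff b^x\in F$. $EL^{alg}:=EL^{(-1)}$ with $\ln(-1)=i\pi$; it equals $EL^{(b)}$ for every algebraic $b\ne0,1$ (any choice of $\ln b$). Its elements are the algebraically based numbers. *)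

theory Defs
  imports "HOL-Analysis.Analysis" "HOL-Computational_Algebra.Polynomial" "HOL-Library.Poly_Mapping"
begin

text \<open>A multivariate polynomial with rational coefficients in variables indexed by nat
  is a finitely supported map from monomials (finitely supported exponent vectors) to Q.\<close>

type_synonym qmpoly = "(nat \<Rightarrow>\<^sub>0 nat) \<Rightarrow>\<^sub>0 rat"

definition mpoly_eval :: "qmpoly \<Rightarrow> (nat \<Rightarrow> complex) \<Rightarrow> complex" where
  "mpoly_eval p x =
     (\<Sum>m\<in>Poly_Mapping.keys p. of_rat (Poly_Mapping.lookup p m) * (\<Prod>i\<in>Poly_Mapping.keys m. x i ^ Poly_Mapping.lookup (m :: nat \<Rightarrow>\<^sub>0 nat) i))"

definition mpoly_vars :: "qmpoly \<Rightarrow> nat set" where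
  "mpoly_vars p = (\<Union>m\<in>Poly_Mapping.keys p. Poly_Mapping.keys m)"

definition alg_indep_Q :: "nat set \<Rightarrow> (nat \<Rightarrow> complex) \<Rightarrow> bool" where
  "alg_indep_Q I x \<longleftrightarrow>
     (\<forall>p. mpoly_vars p \<subseteq> I \<and> mpoly_eval p x = 0 \<longrightarrow> p = 0)"

definition lin_indep_Q :: "nat \<Rightarrow> (nat \<Rightarrow> complex) \<Rightarrow> bool" where
  "lin_indep_Q n z \<longleftrightarrow>
     (\<forall>c :: nat \<Rightarrow> rat. (\<Sum>i<n. of_rat (c i) * z i) = 0 \<longrightarrow> (\<forall>i<n. c i = 0))"

definition schanuel_conjecture :: bool where
  "schanuel_conjecture \<longleftrightarrow>
     (\<forall>n z. lin_indep_Q n z \<longrightarrow>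
        (\<exists>I \<subseteq> {..<2*n}. card I \<ge> n \<and>
           alg_indep_Q I (\<lambda>i. if i < n then z i else exp (z (i - n)))))"

inductive_set gen_field :: "complex set \<Rightarrow> complex set" for S where
  gen_base: "x \<in> S \<Longrightarrow> x \<in> gen_field S"
| gen_zero: "0 \<in> gen_field S"
| gen_one: "1 \<in> gen_field S"
| gen_add: "x \<in> gen_field S \<Longrightarrow> y \<in> gen_field S \<Longrightarrow> x + y \<in> gen_field S"
| gen_uminus: "x \<in> gen_field S \<Longrightarrow> - x \<in> gen_field S"
| gen_mult: "x \<in> gen_field S \<Longrightarrow> y \<in> gen_field S \<Longrightarrow> x * y \<in> gen_field S"
| gen_inverse: "x \<in> gen_field S \<Longrightarrow> inverse x \<in> gen_field S"

definition alg_closure :: "complex set \<Rightarrow> complex set" where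
  "alg_closure F = {z. \<exists>p. p \<noteq> 0 \<and> (\<forall>i. coeff p i \<in> F) \<and> poly p z = 0}"

text \<open>b^x := e^{x ln b} for a fixed choice lnb of ln b.\<close>
definition bpow :: "complex \<Rightarrow> complex \<Rightarrow> complex" where
  "bpow lnb x = exp (x * lnb)"

definition Logb :: "complex \<Rightarrow> complex set \<Rightarrow> complex set" where
  "Logb lnb S = {w. bpow lnb w \<in> S}"

fun EL_level :: "complex \<Rightarrow> nat \<Rightarrow> complex set" where
  "EL_level lnb 0 = \<rat>"
| "EL_level lnb (Suc n) =
     alg_closure (gen_field (EL_level lnb n \<union> bpow lnb ` EL_level lnb n \<union> Logb lnb (EL_level lnb n)))"

definition EL :: "complex \<Rightarrow> complex set" where
  "EL lnb = (\<Union>n. EL_level lnb n)"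

text \<open>EL^alg := EL^(-1) with ln(-1) = i pi.\<close>
definition EL_alg :: "complex set" where
  "EL_alg = EL (\<i> * complex_of_real pi)"

end

theory Submission
  imports "HOL-Algebra.Algebraic_Closure_Type" Defs
begin

text \<open>
  Put \<open>l = i\<pi>\<close>. Every element of \<open>EL_alg\<close> is algebraic over the field generated by finitely many
  numbers \<open>x\<^sub>1 = 1, x\<^sub>2, \<dots>, x\<^sub>n\<close> and their exponentials \<open>exp (l x\<^sub>i)\<close>, where at each stage one of
  \<open>x\<^sub>i\<close>, \<open>exp (l x\<^sub>i)\<close> is algebraic over the previous stage. A number that is linearly independent
  of its predecessors over the rationals thus raises the transcendence degree by at most one, and
  a linearly dependent one does not raise it at all. As \<open>x\<^sub>1\<close> and \<open>exp (l x\<^sub>1) = -1\<close> are algebraic,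
  the transcendence degree is less than the dimension of the rational span. If \<open>l\<close> were algebraic
  over this field, then the numbers \<open>l x\<^sub>i\<close> would contradict the Schanuel conjecture; hence \<open>l\<close> is
  not in \<open>EL_alg\<close>. If \<open>exp L\<close> is in \<open>EL_alg\<close>, then so is \<open>L / l\<close>, and if \<open>L \<noteq> 0\<close> were also in
  \<open>EL_alg\<close>, then so would be \<open>l = L / (L / l)\<close>.
\<close>

hide_const (open) up_ring.coeff up_ring.monom Polynomials.degree Polynomials.lead_coeff

subsection \<open>Subrings and subfields of a field\<close>

abbreviation is_subring :: "'a::field set \<Rightarrow> bool" where
  "is_subring R \<equiv> subring R (ring_of_type_algebra :: 'a ring)"

abbreviation is_subfield :: "'a::field set \<Rightarrow> bool" where
  "is_subfield F \<equiv> subfield F (ring_of_type_algebra :: 'a ring)"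

lemma ring_of_type_algebra_simps [simp]:
  "carrier ring_of_type_algebra = (UNIV :: 'a::field set)"
  "\<zero>\<^bsub>ring_of_type_algebra\<^esub> = (0 :: 'a)"
  "\<one>\<^bsub>ring_of_type_algebra\<^esub> = (1 :: 'a)"
  "x \<oplus>\<^bsub>ring_of_type_algebra\<^esub> y = (x + y :: 'a)"
  "x \<otimes>\<^bsub>ring_of_type_algebra\<^esub> y = (x * y :: 'a)"
  by (simp_all add: ring_of_type_algebra_def)

context
begin

interpretation Type_Field: field "ring_of_type_algebra :: 'a::field ring"
  by (rule field_from_type_algebra)

lemma a_inv_ring_of_type_algebra [simp]: "\<ominus>\<^bsub>ring_of_type_algebra\<^esub> x = - (x :: 'a::field)"
  using Type_Field.minus_equality[of "- x" x] by simp

lemma m_inv_ring_of_type_algebra [simp]: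
  "x \<noteq> 0 \<Longrightarrow> inv\<^bsub>ring_of_type_algebra\<^esub> x = inverse (x :: 'a::field)"
  using Type_Field.inv_char[of x "inverse x"] by simp

lemma nat_pow_ring_of_type_algebra [simp]:
  "x [^]\<^bsub>ring_of_type_algebra\<^esub> n = (x :: 'a::field) ^ n" for n :: nat
  by (induction n) simp_all

lemma is_subringI:
  fixes R :: "'a::field set"
  assumes "1 \<in> R" "\<And>x. x \<in> R \<Longrightarrow> - x \<in> R"
    "\<And>x y. x \<in> R \<Longrightarrow> y \<in> R \<Longrightarrow> x + y \<in> R" "\<And>x y. x \<in> R \<Longrightarrow> y \<in> R \<Longrightarrow> x * y \<in> R"
  shows "is_subring R"
  by (rule Type_Field.subringI) (use assms in auto)

lemma is_subfieldI:
  fixes F :: "'a::field set"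
  assumes "is_subring F" "\<And>x. x \<in> F \<Longrightarrow> inverse x \<in> F"
  shows "is_subfield F"
  by (rule Type_Field.subfieldI') (use assms in auto)

lemma subring_if_subfield: "is_subfield F \<Longrightarrow> is_subring F"
  by (rule subfieldE)

lemma subfield_inverse: "is_subfield F \<Longrightarrow> x \<in> F \<Longrightarrow> inverse x \<in> F"
  using Type_Field.subfield_m_inv(1)[of F x] subringE(2)[OF subring_if_subfield]
  by (cases "x = 0") auto

end

context
  fixes R :: "'a::field set" assumes R: "is_subring R"
begin

lemma subring_0: "0 \<in> R" and subring_1: "1 \<in> R"
  and subring_uminus: "x \<in> R \<Longrightarrow> - x \<in> R"
  and subring_mult: "x \<in> R \<Longrightarrow> y \<in> R \<Longrightarrow> x * y \<in> R"
  and subring_add: "x \<in> R \<Longrightarrow> y \<in> R \<Longrightarrow> x + y \<in> R"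
  using subringE[OF R] by auto

lemma subring_power: "x \<in> R \<Longrightarrow> x ^ n \<in> R"
  by (induction n) (auto intro: subring_1 subring_mult)

lemma subring_sum: "(\<And>i. i \<in> A \<Longrightarrow> f i \<in> R) \<Longrightarrow> sum f A \<in> R"
  by (induction A rule: infinite_finite_induct) (auto intro: subring_0 subring_add)

lemma subring_of_nat: "of_nat n \<in> R"
  by (induction n) (auto intro: subring_0 subring_1 subring_add)

lemma subring_of_int: "of_int n \<in> R"
  by (cases n rule: int_cases2) (auto intro: subring_of_nat subring_uminus)

lemma subring_poly: "(\<And>i. coeff p i \<in> R) \<Longrightarrow> x \<in> R \<Longrightarrow> poly p x \<in> R"
  unfolding poly_altdef by (intro subring_sum subring_mult subring_power)

end

lemma subfield_divide: "is_subfield F \<Longrightarrow> x \<in> F \<Longrightarrow> y \<in> F \<Longrightarrow> x / y \<in> F"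
  unfolding divide_inverse by (intro subring_mult subfield_inverse subring_if_subfield)

lemma subfield_power_int: "is_subfield F \<Longrightarrow> x \<in> F \<Longrightarrow> x powi n \<in> F"
  unfolding power_int_def by (auto intro: subring_power subfield_inverse subring_if_subfield)

lemma subfield_of_rat: "is_subfield F \<Longrightarrow> of_rat r \<in> F" for F :: "'a::field_char_0 set"
  by (cases r) (auto simp: of_rat_rat intro!: subfield_divide subring_of_int subring_if_subfield)

lemma is_subfield_gen_field: "is_subfield (gen_field S)"
  by (intro is_subfieldI is_subringI) (auto intro: gen_field.intros)

lemma gen_field_least:
  assumes F: "is_subfield F" and "S \<subseteq> F"
  shows "gen_field S \<subseteq> F"
proof
  fix x assume "x \<in> gen_field S"
  thus "x \<in> F"
    by induction (use assms in \<open>auto intro: subring_0 subring_1 subring_uminus subfield_inverse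
      subring_add subring_mult subring_if_subfield\<close>)
qed

lemma gen_field_mono: "S \<subseteq> T \<Longrightarrow> gen_field S \<subseteq> gen_field T"
  by (rule gen_field_least[OF is_subfield_gen_field]) (auto intro: gen_base)

subsection \<open>Algebraic closure of a subfield\<close>

lemma subset_alg_closure:
  assumes F: "is_subfield F"
  shows "F \<subseteq> alg_closure F"
proof
  fix x assume "x \<in> F"
  hence "0 \<in> F" "1 \<in> F" "- x \<in> F"
    using subring_if_subfield[OF F] by (auto intro: subring_0 subring_1 subring_uminus)
  thus "x \<in> alg_closure F"
    unfolding alg_closure_def
    by (intro CollectI exI[of _ "[:- x, 1:]"]) (auto simp: coeff_pCons split: nat.split)
qed

lemma (in field) algebraic_over_algebraics:
  assumes K: "subfield K R" and z: "z \<in> carrier R"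
    and alg: "(algebraic over {x \<in> carrier R. (algebraic over K) x}) z"
  shows "(algebraic over K) z"
proof -
  have "subring {x \<in> carrier R. (algebraic over K) x} R"
    by (intro subfieldE(1) subfield_of_algebraics K)
  then obtain p where p: "polynomial {x \<in> carrier R. (algebraic over K) x} p"
    "p \<noteq> []" "eval p z = \<zero>"
    using algebraicE[OF _ z alg] by (auto simp: univ_poly_carrier[symmetric])
  define L where "L = finite_extension K p"
  have coeffs: "set p \<subseteq> carrier R" "\<And>x. x \<in> set p \<Longrightarrow> (algebraic over K) x"
    using p(1) by (auto simp: polynomial_def)
  have L: "subfield L R" "finite_dimension K L"
    unfolding L_def
    using finite_extension_is_subfield[OF K coeffs]
      finite_extension_finite_dimension(1)[OF K coeffs] by auto
  have "set p \<subseteq> L"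
    unfolding L_def by (intro finite_extension_mem subfieldE(1) K coeffs)
  hence "p \<in> carrier (L[X])"
    using p(1) by (auto simp: univ_poly_carrier[symmetric] polynomial_def)
  hence "(algebraic over L) z"
    using p by (intro algebraicI)
  hence "finite_dimension K (simple_extension L z)"
    using telescopic_base_dim(1)[OF K L] finite_dimension_simple_extension[OF L(1) z] by blast
  moreover have "subring (simple_extension L z) R" "z \<in> simple_extension L z"
    using L(1) z by (auto intro: simple_extension_is_subring simple_extension_mem subfieldE(1))
  ultimately show ?thesis
    using finite_dimension_imp_algebraic[OF K] by blast
qed

context
begin

interpretation Type_Field: field "ring_of_type_algebra :: 'a::field ring"
  by (rule field_from_type_algebra)

lemma eval_ring_of_type_algebra:
  "Type_Field.eval xs x = poly (Poly (rev xs)) (x :: 'a::field)"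
  by (induction xs) (auto simp: Poly_append poly_monom)

lemma algebraic_over_iff:
  fixes F :: "'a::field set"
  assumes F: "is_subring F"
  shows "(Type_Field.algebraic over F) z \<longleftrightarrow> (\<exists>p. p \<noteq> 0 \<and> (\<forall>i. coeff p i \<in> F) \<and> poly p z = 0)"
proof
  assume "(Type_Field.algebraic over F) z"
  then obtain xs where xs: "polynomial\<^bsub>ring_of_type_algebra\<^esub> F xs"
    "xs \<noteq> []" "Type_Field.eval xs z = 0"
    using Type_Field.algebraicE[OF F, of z]
    by (auto simp: univ_poly_carrier[symmetric])
  show "\<exists>p. p \<noteq> 0 \<and> (\<forall>i. coeff p i \<in> F) \<and> poly p z = 0"
  proof (intro exI conjI allI)
    show "Poly (rev xs) \<noteq> 0"
      using xs(1,2) by (auto simp: polynomial_def Poly_eq_0 dest!: arg_cong[of _ _ set])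
    show "coeff (Poly (rev xs)) i \<in> F" for i
      using xs(1) subring_0[OF F]
      by (auto simp: polynomial_def nth_default_def rev_nth)
    show "poly (Poly (rev xs)) z = 0"
      using xs(3) by (simp add: eval_ring_of_type_algebra)
  qed
next
  assume "\<exists>p. p \<noteq> 0 \<and> (\<forall>i. coeff p i \<in> F) \<and> poly p z = 0"
  then obtain p where p: "p \<noteq> 0" "\<forall>i. coeff p i \<in> F" "poly p z = 0" by blast
  show "(Type_Field.algebraic over F) z"
  proof (rule Type_Field.algebraicI)
    show "rev (coeffs p) \<in> carrier (F [X]\<^bsub>ring_of_type_algebra\<^esub>)"
      using p by (auto simp: univ_poly_carrier[symmetric] polynomial_def coeffs_def hd_rev last_map
        simp del: upt_Suc)
    show "Type_Field.eval (rev (coeffs p)) z = \<zero>\<^bsub>ring_of_type_algebra\<^esub>"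
      using p(3) by (simp add: eval_ring_of_type_algebra)
  qed (use p in auto)
qed

lemma alg_closure_eq_algebraics:
  assumes "is_subfield F"
  shows "alg_closure F = {z. (Type_Field.algebraic over F) z}"
  using assms by (simp add: alg_closure_def algebraic_over_iff subring_if_subfield)

lemma is_subfield_alg_closure: "is_subfield F \<Longrightarrow> is_subfield (alg_closure F)"
  using Type_Field.subfield_of_algebraics[of F] by (simp add: alg_closure_eq_algebraics)

lemma alg_closure_alg_closure_subset:
  assumes F: "is_subfield F"
  shows "alg_closure (alg_closure F) \<subseteq> alg_closure F"
proof
  fix z assume "z \<in> alg_closure (alg_closure F)"
  hence "(Type_Field.algebraic over alg_closure F) z"
    using alg_closure_eq_algebraics[OF is_subfield_alg_closure[OF F]] by blast
  thus "z \<in> alg_closure F"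
    using Type_Field.algebraic_over_algebraics[OF F, of z]
    by (simp add: alg_closure_eq_algebraics[OF F])
qed

end

subsection \<open>Algebraically closed subfields of the complex numbers\<close>

definition alg_closed_subfield :: "complex set \<Rightarrow> bool" where
  "alg_closed_subfield K \<longleftrightarrow> is_subfield K \<and> alg_closure K \<subseteq> K"

lemma subfield_if_alg_closed: "alg_closed_subfield K \<Longrightarrow> is_subfield K"
  by (simp add: alg_closed_subfield_def)

lemma subring_if_alg_closed: "alg_closed_subfield K \<Longrightarrow> is_subring K"
  by (intro subring_if_subfield subfield_if_alg_closed)

lemma alg_closed_poly_root:
  assumes "alg_closed_subfield K" "p \<noteq> 0" "\<And>i. coeff p i \<in> K" "poly p z = 0"
  shows "z \<in> K"
  using assms unfolding alg_closed_subfield_def alg_closure_def by blast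

lemma alg_closed_nth_root:
  assumes K: "alg_closed_subfield K" and "n > 0" "z ^ n \<in> K"
  shows "z \<in> K"
proof (rule alg_closed_poly_root[OF K])
  show "monom 1 n - [:z ^ n:] \<noteq> 0"
    using \<open>n > 0\<close> degree_monom_eq[of "1 :: complex" n] degree_pCons_0[of "z ^ n"] by auto
  show "coeff (monom 1 n - [:z ^ n:]) i \<in> K" for i
    using assms subring_if_alg_closed[OF K]
    by (auto simp: coeff_pCons intro!: subring_0 subring_1 subring_uminus split: nat.split)
  show "poly (monom 1 n - [:z ^ n:]) z = 0"
    by (simp add: poly_monom)
qed

lemma alg_closed_contains_algebraic:
  assumes K: "alg_closed_subfield K" and "algebraic z"
  shows "z \<in> K"
proof -
  obtain p where "p \<noteq> 0" "\<And>i. coeff p i \<in> \<int>" "poly p z = 0"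
    using \<open>algebraic z\<close> by (auto elim: algebraicE)
  moreover have "\<int> \<subseteq> K"
    by (auto elim!: Ints_cases intro: subring_of_int subring_if_alg_closed[OF K])
  ultimately show ?thesis
    using alg_closed_poly_root[OF K] by blast
qed

lemma finite_subset_directed_Union:
  assumes "finite A" "A \<subseteq> \<Union>\<F>" "\<F> \<noteq> {}"
    and directed: "\<And>K L. K \<in> \<F> \<Longrightarrow> L \<in> \<F> \<Longrightarrow> \<exists>M\<in>\<F>. K \<union> L \<subseteq> M"
  obtains K where "K \<in> \<F>" "A \<subseteq> K"
proof -
  from assms(1,2) have "\<exists>K\<in>\<F>. A \<subseteq> K"
  proof (induction A rule: finite_induct)
    case empty
    thus ?case using \<open>\<F> \<noteq> {}\<close> by blast
  next
    case (insert a A)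
    then obtain K L where KL: "K \<in> \<F>" "A \<subseteq> K" "L \<in> \<F>" "a \<in> L" by auto
    obtain M where "M \<in> \<F>" "K \<union> L \<subseteq> M" using directed[OF KL(1,3)] by blast
    thus ?case using KL by (intro bexI[of _ M]) auto
  qed
  thus thesis using that by blast
qed

lemma alg_closed_subfield_directed_Union:
  assumes closed: "\<And>K. K \<in> \<F> \<Longrightarrow> alg_closed_subfield K" and "\<F> \<noteq> {}"
    and directed: "\<And>K L. K \<in> \<F> \<Longrightarrow> L \<in> \<F> \<Longrightarrow> \<exists>M\<in>\<F>. K \<union> L \<subseteq> M"
  shows "alg_closed_subfield (\<Union>\<F>)"
proof -
  note finite_subset = finite_subset_directed_Union[OF _ _ \<open>\<F> \<noteq> {}\<close> directed]
  have field: "is_subfield K" and ring: "is_subring K" if "K \<in> \<F>" for K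
    using closed[OF that] by (auto intro: subfield_if_alg_closed subring_if_alg_closed)
  have "is_subfield (\<Union>\<F>)"
  proof (intro is_subfieldI is_subringI)
    show "1 \<in> \<Union>\<F>"
      using \<open>\<F> \<noteq> {}\<close> ring subring_1 by blast
    show "- x \<in> \<Union>\<F>" "inverse x \<in> \<Union>\<F>" if "x \<in> \<Union>\<F>" for x
      using that field ring subring_uminus subfield_inverse by blast+
    fix x y assume "x \<in> \<Union>\<F>" "y \<in> \<Union>\<F>"
    then obtain K where "K \<in> \<F>" "x \<in> K" "y \<in> K"
      using finite_subset[of "{x, y}"] by auto
    thus "x + y \<in> \<Union>\<F>" "x * y \<in> \<Union>\<F>"
      using ring subring_add subring_mult by blast+
  qed
  moreover have "z \<in> \<Union>\<F>" if "z \<in> alg_closure (\<Union>\<F>)" for z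
  proof -
    obtain p where p: "p \<noteq> 0" "range (coeff p) \<subseteq> \<Union>\<F>" "poly p z = 0"
      using \<open>z \<in> alg_closure (\<Union>\<F>)\<close> unfolding alg_closure_def by blast
    obtain K where "K \<in> \<F>" "range (coeff p) \<subseteq> K"
      using finite_subset[of "range (coeff p)"] p(2) by (auto simp: range_coeff)
    thus ?thesis using alg_closed_poly_root[OF closed p(1) _ p(3)] by blast
  qed
  ultimately show ?thesis by (auto simp: alg_closed_subfield_def)
qed

definition acl :: "complex set \<Rightarrow> complex set" where
  "acl S = alg_closure (gen_field S)"

lemma alg_closed_acl: "alg_closed_subfield (acl S)"
  unfolding alg_closed_subfield_def acl_def
  by (intro conjI is_subfield_alg_closure alg_closure_alg_closure_subset is_subfield_gen_field)

lemma subset_acl: "S \<subseteq> acl S"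
  using subset_alg_closure[OF is_subfield_gen_field, of S] gen_base unfolding acl_def by blast

lemma acl_least:
  assumes "alg_closed_subfield K" "S \<subseteq> K"
  shows "acl S \<subseteq> K"
proof -
  have "gen_field S \<subseteq> K"
    using assms by (intro gen_field_least subfield_if_alg_closed)
  hence "acl S \<subseteq> alg_closure K"
    unfolding acl_def alg_closure_def by blast
  thus ?thesis
    using assms(1) unfolding alg_closed_subfield_def by blast
qed

lemma acl_mono: "S \<subseteq> T \<Longrightarrow> acl S \<subseteq> acl T"
  using subset_acl[of T] by (intro acl_least alg_closed_acl) blast

subsection \<open>Closure operators with exchange\<close>

locale exchange_closure =
  fixes cl :: "'a set \<Rightarrow> 'a set"
  assumes subset_cl: "A \<subseteq> cl A"
    and cl_least: "A \<subseteq> cl B \<Longrightarrow> cl A \<subseteq> cl B"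
    and exchange: "y \<in> cl (insert x A) \<Longrightarrow> y \<notin> cl A \<Longrightarrow> x \<in> cl (insert y A)"
begin

definition indep :: "'a set \<Rightarrow> bool" where
  "indep A \<longleftrightarrow> (\<forall>a\<in>A. a \<notin> cl (A - {a}))"

lemma cl_mono: "A \<subseteq> B \<Longrightarrow> cl A \<subseteq> cl B"
  using cl_least subset_cl by blast

lemma indep_subset:
  assumes "indep B" "A \<subseteq> B"
  shows "indep A"
  unfolding indep_def
proof
  fix a assume "a \<in> A"
  thus "a \<notin> cl (A - {a})"
    using assms cl_mono[of "A - {a}" "B - {a}"] unfolding indep_def by blast
qed

lemma indep_insert:
  assumes "indep A" "x \<notin> cl A"
  shows "indep (insert x A)"
  unfolding indep_def
proof
  fix a assume a: "a \<in> insert x A"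
  have "x \<notin> A" using \<open>x \<notin> cl A\<close> subset_cl by blast
  show "a \<notin> cl (insert x A - {a})"
  proof (cases "a = x")
    case True
    thus ?thesis using \<open>x \<notin> A\<close> \<open>x \<notin> cl A\<close> by simp
  next
    case False
    hence "insert x A - {a} = insert x (A - {a})" "insert a (A - {a}) = A" using a by auto
    thus ?thesis
      using exchange[of a x "A - {a}"] assms a False unfolding indep_def by auto
  qed
qed

lemma indep_card_le:
  assumes "finite A" "finite T" "indep A" "A \<subseteq> cl T"
  shows "card A \<le> card T"
  using assms
proof (induction "card (A - T)" arbitrary: A rule: less_induct)
  case less
  show ?case
  proof (cases "A \<subseteq> T")
    case True
    thus ?thesis using less.prems card_mono by blast
  next
    case False
    then obtain a where a: "a \<in> A" "a \<notin> T" by blast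
    have "\<not> T \<subseteq> cl (A - {a})"
      using cl_least[of T "A - {a}"] less.prems(3,4) a(1) unfolding indep_def by blast
    then obtain t where t: "t \<in> T" "t \<notin> cl (A - {a})" by blast
    define B where "B = insert t (A - {a})"
    have "B - T \<subset> A - T" using a t by (auto simp: B_def)
    hence "card (B - T) < card (A - T)"
      using less.prems(1) by (intro psubset_card_mono) auto
    moreover have "finite B" "B \<subseteq> cl T"
      using less.prems t(1) subset_cl[of T] by (auto simp: B_def)
    moreover have "indep B"
      unfolding B_def by (intro indep_insert t(2) indep_subset[OF less.prems(3)]) auto
    ultimately have "card B \<le> card T"
      using less.hyps less.prems(2) by blast
    moreover have "t \<notin> A - {a}" using t(2) subset_cl[of "A - {a}"] by blast
    hence "card B = card A"
      using card_Suc_Diff1[OF less.prems(1) a(1)] less.prems(1) by (simp add: B_def)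
    ultimately show ?thesis by simp
  qed
qed

end

subsection \<open>Clearing denominators\<close>

definition fractions :: "'a::field set \<Rightarrow> 'a set" where
  "fractions R = {a / b | a b. a \<in> R \<and> b \<in> R \<and> b \<noteq> 0}"

lemma fractionsI: "a \<in> R \<Longrightarrow> b \<in> R \<Longrightarrow> b \<noteq> 0 \<Longrightarrow> x = a / b \<Longrightarrow> x \<in> fractions R"
  unfolding fractions_def by blast

lemma fractionsE:
  assumes "x \<in> fractions R"
  obtains a b where "a \<in> R" "b \<in> R" "b \<noteq> 0" "x = a / b"
  using assms unfolding fractions_def by blast

lemma subset_fractions: "is_subring R \<Longrightarrow> R \<subseteq> fractions R"
  by (auto intro: fractionsI[of _ R 1] subring_1)

lemma is_subfield_fractions:
  assumes R: "is_subring R"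
  shows "is_subfield (fractions R)"
proof (intro is_subfieldI is_subringI)
  show "1 \<in> fractions R"
    using subset_fractions[OF R] subring_1[OF R] by blast
next
  fix x assume "x \<in> fractions R"
  then obtain a b where x: "a \<in> R" "b \<in> R" "b \<noteq> 0" "x = a / b" by (rule fractionsE)
  show "- x \<in> fractions R"
    using x by (intro fractionsI[of "- a" R b] subring_uminus[OF R]) auto
  show "inverse x \<in> fractions R"
    using x subset_fractions[OF R] by (cases "a = 0") (auto intro: fractionsI[of b R a])
next
  fix x y assume "x \<in> fractions R" "y \<in> fractions R"
  from \<open>x \<in> fractions R\<close> obtain a b where x: "a \<in> R" "b \<in> R" "b \<noteq> 0" "x = a / b"
    by (rule fractionsE)
  from \<open>y \<in> fractions R\<close> obtain c d where y: "c \<in> R" "d \<in> R" "d \<noteq> 0" "y = c / d"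
    by (rule fractionsE)
  show "x + y \<in> fractions R"
    using x y
    by (intro fractionsI[of "a * d + c * b" R "b * d"] subring_add[OF R] subring_mult[OF R])
      (auto simp: add_frac_eq)
  show "x * y \<in> fractions R"
    using x y by (intro fractionsI[of "a * c" R "b * d"] subring_mult[OF R]) auto
qed

lemma common_denominator:
  assumes R: "is_subring R" and "finite A" "A \<subseteq> fractions R"
  obtains d where "d \<in> R" "d \<noteq> 0" "\<And>a. a \<in> A \<Longrightarrow> d * a \<in> R"
proof -
  from assms(2,3) have "\<exists>d\<in>R. d \<noteq> 0 \<and> (\<forall>a\<in>A. d * a \<in> R)"
  proof (induction A rule: finite_induct)
    case empty
    thus ?case using subring_1[OF R] by (intro bexI[of _ 1]) auto
  next
    case (insert x A)
    then obtain d where d: "d \<in> R" "d \<noteq> 0" "\<forall>a\<in>A. d * a \<in> R" by auto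
    obtain a b where x: "a \<in> R" "b \<in> R" "b \<noteq> 0" "x = a / b"
      using insert.prems by (auto elim: fractionsE)
    have "b * d * y \<in> R" if "y \<in> insert x A" for y
    proof (cases "y = x")
      case True
      hence "b * d * y = d * a" unfolding x(4) using x(3) by simp
      also have "d * a \<in> R" using d(1) x(1) by (rule subring_mult[OF R])
      finally show ?thesis .
    next
      case False
      thus ?thesis using that d(3) x(2) by (simp add: subring_mult[OF R] mult.assoc)
    qed
    thus ?case
      using d x by (intro bexI[of _ "b * d"]) (auto intro: subring_mult[OF R])
  qed
  thus thesis using that by blast
qed

lemma acl_subringE:
  assumes R: "is_subring R" and "S \<subseteq> R" and z: "z \<in> acl S"
  obtains p where "p \<noteq> 0" "\<And>i. coeff p i \<in> R" "poly p z = 0"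
proof -
  have "gen_field S \<subseteq> fractions R"
    using subset_fractions[OF R] \<open>S \<subseteq> R\<close> by (intro gen_field_least is_subfield_fractions R) auto
  then obtain p where p: "p \<noteq> 0" "range (coeff p) \<subseteq> fractions R" "poly p z = 0"
    using z unfolding acl_def alg_closure_def by blast
  obtain d where d: "d \<in> R" "d \<noteq> 0" "\<And>a. a \<in> range (coeff p) \<Longrightarrow> d * a \<in> R"
    using common_denominator[OF R _ p(2)] by (auto simp: range_coeff)
  show thesis
    using that[of "smult d p"] p d by simp
qed

subsection \<open>Exchange for algebraic closure\<close>

lemma simple_extensionE:
  assumes F: "is_subring F" and "x \<in> ring.simple_extension ring_of_type_algebra F t"
  obtains f where "\<And>i. coeff f i \<in> F" "x = poly f t"
proof -
  interpret Type_Field: field "ring_of_type_algebra :: 'a ring"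
    by (rule field_from_type_algebra)
  from assms(2) have "\<exists>f. (\<forall>i. coeff f i \<in> F) \<and> x = poly f t"
  proof (induction rule: Type_Field.simple_extension.induct)
    case zero
    show ?case using subring_0[OF F] by (intro exI[of _ 0]) auto
  next
    case (lin x a)
    then obtain f where "\<forall>i. coeff f i \<in> F" "x = poly f t" by blast
    thus ?case
      using lin(2) by (intro exI[of _ "pCons a f"]) (auto simp: coeff_pCons split: nat.split)
  qed
  thus thesis using that by blast
qed

lemma poly_const_poly: "poly (poly P [:y:]) t = poly (map_poly (\<lambda>f. poly f t) P) y"
  for P :: "'a::comm_semiring_1 poly poly"
  by (induction P) (simp_all add: map_poly_pCons)

lemma coeff_poly_const_poly: "coeff (poly P [:y:]) i = poly (map_poly (\<lambda>f. coeff f i) P) y"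
  for P :: "'a::comm_semiring_1 poly poly"
  by (induction P) (simp_all add: map_poly_pCons)

lemma poly_coeffs_simple_extensionE:
  assumes F: "is_subring F" and "\<And>k. coeff p k \<in> ring.simple_extension ring_of_type_algebra F t"
  obtains P where "\<And>k i. coeff (coeff P k) i \<in> F" "p = map_poly (\<lambda>f. poly f t) P"
proof -
  from assms(2) have "\<exists>P. (\<forall>k i. coeff (coeff P k) i \<in> F) \<and> p = map_poly (\<lambda>f. poly f t) P"
  proof (induction p)
    case 0
    show ?case using subring_0[OF F] by (intro exI[of _ 0]) auto
  next
    case (pCons a p)
    have "coeff p k \<in> ring.simple_extension ring_of_type_algebra F t" for k
      using pCons.prems[of "Suc k"] by simp
    then obtain P where P: "\<forall>k i. coeff (coeff P k) i \<in> F" "p = map_poly (\<lambda>f. poly f t) P"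
      using pCons.IH by blast
    obtain f where "\<And>i. coeff f i \<in> F" "a = poly f t"
      using simple_extensionE[OF F] pCons.prems[of 0] by auto
    thus ?case
      using P by (intro exI[of _ "pCons f P"])
        (auto simp: map_poly_pCons coeff_pCons split: nat.split)
  qed
  thus thesis using that by blast
qed

text \<open>
  For a bivariate polynomial \<open>P\<close> with \<open>P(t, y) = 0\<close>, the coefficients of \<open>P(T, y)\<close> as a polynomial
  in \<open>T\<close> are polynomials in \<open>y\<close> over the field generated by \<open>S\<close>, so they do not all vanish.
\<close>

lemma acl_exchange:
  assumes y: "y \<in> acl (insert t S)" "y \<notin> acl S"
  shows "t \<in> acl (insert y S)"
proof -
  interpret Complex: field "ring_of_type_algebra :: complex ring"
    by (rule field_from_type_algebra)
  define F where "F = gen_field S"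
  have F: "is_subring F"
    unfolding F_def by (intro subring_if_subfield is_subfield_gen_field)
  let ?Ft = "Complex.simple_extension F t"
  have subset: "insert t S \<subseteq> ?Ft"
    using Complex.simple_extension_mem[OF F, of t] Complex.simple_extension_incl[of F t]
    by (auto simp: F_def gen_base)
  have "is_subring ?Ft"
    by (rule Complex.simple_extension_is_subring[OF F]) simp
  then obtain p where p: "p \<noteq> 0" "\<And>k. coeff p k \<in> ?Ft" "poly p y = 0"
    using acl_subringE[OF _ subset y(1)] by blast
  obtain P where P: "\<And>k i. coeff (coeff P k) i \<in> F" "p = map_poly (\<lambda>f. poly f t) P"
    using poly_coeffs_simple_extensionE[OF F p(2)] by blast
  define q where "q = poly P [:y:]"
  have "P \<noteq> 0"
    using p(1) P(2) by auto
  then obtain k i where "coeff (coeff P k) i \<noteq> 0"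
    by (metis leading_coeff_0_iff)
  hence "map_poly (\<lambda>f. coeff f i) P \<noteq> 0"
    by (metis coeff_0 coeff_map_poly)
  hence "coeff q i \<noteq> 0"
    using y(2) P(1) unfolding q_def coeff_poly_const_poly
    by (auto simp: acl_def alg_closure_def F_def[symmetric] coeff_map_poly)
  hence "q \<noteq> 0" by auto
  moreover have "coeff q i \<in> gen_field (insert y S)" for i
  proof -
    have "F \<subseteq> gen_field (insert y S)"
      unfolding F_def by (intro gen_field_mono) auto
    thus ?thesis
      unfolding q_def coeff_poly_const_poly using P(1)
      by (intro subring_poly subring_if_subfield is_subfield_gen_field)
        (auto simp: coeff_map_poly intro: gen_base)
  qed
  moreover have "poly q t = 0"
    using p(3) by (simp add: q_def poly_const_poly P(2))
  ultimately show ?thesis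
    unfolding acl_def alg_closure_def by blast
qed

interpretation acl: exchange_closure acl
proof
  fix A B :: "complex set" and x y :: complex
  show "A \<subseteq> acl A" by (rule subset_acl)
  show "A \<subseteq> acl B \<Longrightarrow> acl A \<subseteq> acl B" by (rule acl_least[OF alg_closed_acl])
  show "y \<in> acl (insert x A) \<Longrightarrow> y \<notin> acl A \<Longrightarrow> x \<in> acl (insert y A)" by (rule acl_exchange)
qed

subsection \<open>Algebraic independence\<close>

definition mono_eval :: "(nat \<Rightarrow>\<^sub>0 nat) \<Rightarrow> (nat \<Rightarrow> complex) \<Rightarrow> complex" where
  "mono_eval m x = (\<Prod>i\<in>Poly_Mapping.keys m. x i ^ Poly_Mapping.lookup m i)"

abbreviation var_power :: "nat \<Rightarrow> nat \<Rightarrow> qmpoly" where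
  "var_power i k \<equiv> Poly_Mapping.single (Poly_Mapping.single i k) 1"

lemma mono_eval_superset:
  assumes "finite A" "Poly_Mapping.keys m \<subseteq> A"
  shows "mono_eval m x = (\<Prod>i\<in>A. x i ^ Poly_Mapping.lookup m i)"
  unfolding mono_eval_def by (rule prod.mono_neutral_left) (use assms in \<open>auto simp: in_keys_iff\<close>)

lemma mono_eval_single: "mono_eval (Poly_Mapping.single i k) x = x i ^ k"
  by (simp add: mono_eval_superset[of "{i}"])

lemma mono_eval_add: "mono_eval (m + n) x = mono_eval m x * mono_eval n x"
proof -
  let ?A = "Poly_Mapping.keys m \<union> Poly_Mapping.keys n"
  have "mono_eval (m + n) x = (\<Prod>i\<in>?A. x i ^ Poly_Mapping.lookup (m + n) i)"
    by (rule mono_eval_superset) (use keys_add[of m n] in auto)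
  also have "\<dots> = (\<Prod>i\<in>?A. x i ^ Poly_Mapping.lookup m i) * (\<Prod>i\<in>?A. x i ^ Poly_Mapping.lookup n i)"
    by (simp add: lookup_add power_add prod.distrib)
  also have "\<dots> = mono_eval m x * mono_eval n x"
    by (simp add: mono_eval_superset[of ?A])
  finally show ?thesis .
qed

lemma mpoly_eval_superset:
  assumes "finite A" "Poly_Mapping.keys p \<subseteq> A"
  shows "mpoly_eval p x = (\<Sum>m\<in>A. of_rat (Poly_Mapping.lookup p m) * mono_eval m x)"
  unfolding mpoly_eval_def mono_eval_def[symmetric]
  by (rule sum.mono_neutral_left) (use assms in \<open>auto simp: in_keys_iff\<close>)

lemma mpoly_eval_single: "mpoly_eval (Poly_Mapping.single m c) x = of_rat c * mono_eval m x"
  by (simp add: mpoly_eval_superset[of "{m}"])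

lemma mpoly_eval_0: "mpoly_eval 0 x = 0"
  by (simp add: mpoly_eval_def)

lemma mpoly_eval_1: "mpoly_eval 1 x = 1"
  by (simp add: mpoly_eval_def)

lemma mpoly_eval_add: "mpoly_eval (p + q) x = mpoly_eval p x + mpoly_eval q x"
proof -
  let ?A = "Poly_Mapping.keys p \<union> Poly_Mapping.keys q"
  have "mpoly_eval (p + q) x = (\<Sum>m\<in>?A. of_rat (Poly_Mapping.lookup (p + q) m) * mono_eval m x)"
    by (rule mpoly_eval_superset) (use keys_add[of p q] in auto)
  thus ?thesis
    by (simp add: lookup_add of_rat_add distrib_right sum.distrib mpoly_eval_superset[of ?A])
qed

lemma mpoly_eval_uminus: "mpoly_eval (- p) x = - mpoly_eval p x"
  using mpoly_eval_add[of p "- p" x] by (simp add: mpoly_eval_0 add_eq_0_iff)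

lemma mpoly_eval_sum: "mpoly_eval (sum f A) x = (\<Sum>a\<in>A. mpoly_eval (f a) x)"
  by (induction A rule: infinite_finite_induct) (auto simp: mpoly_eval_0 mpoly_eval_add)

lemma poly_mapping_eq_sum_single:
  "p = (\<Sum>m\<in>Poly_Mapping.keys p. Poly_Mapping.single m (Poly_Mapping.lookup p m))"
  by (rule poly_mapping_eqI) (auto simp: lookup_sum lookup_single when_def in_keys_iff)

lemma mpoly_eval_mult: "mpoly_eval (p * q) x = mpoly_eval p x * mpoly_eval q x"
proof -
  let ?s = "\<lambda>p m. Poly_Mapping.single m (Poly_Mapping.lookup p m) :: qmpoly"
  have "p * q = (\<Sum>m\<in>Poly_Mapping.keys p. \<Sum>n\<in>Poly_Mapping.keys q. ?s p m * ?s q n)"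
    by (subst poly_mapping_eq_sum_single[of p], subst poly_mapping_eq_sum_single[of q])
      (rule sum_product)
  hence "mpoly_eval (p * q) x = (\<Sum>m\<in>Poly_Mapping.keys p. \<Sum>n\<in>Poly_Mapping.keys q.
      (of_rat (Poly_Mapping.lookup p m) * mono_eval m x) *
      (of_rat (Poly_Mapping.lookup q n) * mono_eval n x))"
    by (simp add: mpoly_eval_sum mult_single mpoly_eval_single mono_eval_add of_rat_mult mult_ac)
  also have "\<dots> = mpoly_eval p x * mpoly_eval q x"
    unfolding mpoly_eval_def mono_eval_def[symmetric] by (rule sum_product[symmetric])
  finally show ?thesis .
qed

lemma mpoly_vars_add: "mpoly_vars (p + q) \<subseteq> mpoly_vars p \<union> mpoly_vars q"
  using keys_add[of p q] unfolding mpoly_vars_def by blast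

lemma mpoly_vars_uminus: "mpoly_vars (- p) = mpoly_vars p"
  by (auto simp: mpoly_vars_def in_keys_iff)

lemma mpoly_vars_mult: "mpoly_vars (p * q) \<subseteq> mpoly_vars p \<union> mpoly_vars q"
proof
  fix i assume "i \<in> mpoly_vars (p * q)"
  then obtain m where m: "m \<in> Poly_Mapping.keys (p * q)" "i \<in> Poly_Mapping.keys m"
    by (auto simp: mpoly_vars_def)
  then obtain a b where "m = a + b" "a \<in> Poly_Mapping.keys p" "b \<in> Poly_Mapping.keys q"
    using keys_mult[of p q] by blast
  thus "i \<in> mpoly_vars p \<union> mpoly_vars q"
    using m keys_add[of a b] by (auto simp: mpoly_vars_def)
qed

lemma mpoly_vars_sum: "mpoly_vars (sum f A) \<subseteq> (\<Union>a\<in>A. mpoly_vars (f a))"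
proof (induction A rule: infinite_finite_induct)
  case (insert a A)
  thus ?case using mpoly_vars_add[of "f a" "sum f A"] by auto
qed (auto simp: mpoly_vars_def)

lemma mpoly_vars_single: "mpoly_vars (Poly_Mapping.single m c) \<subseteq> Poly_Mapping.keys m"
  by (auto simp: mpoly_vars_def)

definition mpoly_values :: "(nat \<Rightarrow> complex) \<Rightarrow> nat set \<Rightarrow> complex set" where
  "mpoly_values x I = {mpoly_eval p x | p. mpoly_vars p \<subseteq> I}"

lemma mpoly_valuesI: "mpoly_vars p \<subseteq> I \<Longrightarrow> mpoly_eval p x = y \<Longrightarrow> y \<in> mpoly_values x I"
  unfolding mpoly_values_def by blast

lemma mpoly_valuesE:
  assumes "y \<in> mpoly_values x I"
  obtains p where "mpoly_vars p \<subseteq> I" "y = mpoly_eval p x"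
  using assms unfolding mpoly_values_def by blast

lemma is_subring_mpoly_values: "is_subring (mpoly_values x I)"
proof (rule is_subringI)
  show "1 \<in> mpoly_values x I"
    by (rule mpoly_valuesI[of 1]) (auto simp: mpoly_eval_1 mpoly_vars_def)
next
  fix y assume "y \<in> mpoly_values x I"
  then obtain p where "mpoly_vars p \<subseteq> I" "y = mpoly_eval p x" by (rule mpoly_valuesE)
  thus "- y \<in> mpoly_values x I"
    by (intro mpoly_valuesI[of "- p"]) (auto simp: mpoly_eval_uminus mpoly_vars_uminus)
next
  fix y z assume "y \<in> mpoly_values x I" "z \<in> mpoly_values x I"
  then obtain p q where pq: "mpoly_vars p \<subseteq> I" "y = mpoly_eval p x"
    "mpoly_vars q \<subseteq> I" "z = mpoly_eval q x"
    by (meson mpoly_valuesE)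
  show "y + z \<in> mpoly_values x I"
    using pq mpoly_vars_add[of p q]
    by (intro mpoly_valuesI[of "p + q"]) (auto simp: mpoly_eval_add)
  show "y * z \<in> mpoly_values x I"
    using pq mpoly_vars_mult[of p q]
    by (intro mpoly_valuesI[of "p * q"]) (auto simp: mpoly_eval_mult)
qed

lemma image_subset_mpoly_values: "x ` I \<subseteq> mpoly_values x I"
proof
  fix y assume "y \<in> x ` I"
  then obtain i where "i \<in> I" "y = x i" by blast
  thus "y \<in> mpoly_values x I"
    using mpoly_vars_single[of "Poly_Mapping.single i 1" 1]
    by (intro mpoly_valuesI[of "var_power i 1"]) (auto simp: mpoly_eval_single mono_eval_single)
qed

lemma lookup_mult_single_add:
  fixes p :: "'a::cancel_comm_monoid_add \<Rightarrow>\<^sub>0 'b::comm_semiring_1"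
  shows "Poly_Mapping.lookup (p * Poly_Mapping.single n c) (m + n) = Poly_Mapping.lookup p m * c"
proof -
  have "p * Poly_Mapping.single n c =
      (\<Sum>l\<in>Poly_Mapping.keys p. Poly_Mapping.single (l + n) (Poly_Mapping.lookup p l * c))"
    by (subst poly_mapping_eq_sum_single[of p]) (simp add: sum_distrib_right mult_single)
  thus ?thesis
    by (auto simp: lookup_sum lookup_single when_def in_keys_iff)
qed

lemma lookup_mult_var_power_neq:
  assumes "i \<notin> mpoly_vars q" "i \<notin> Poly_Mapping.keys m" "k \<noteq> l"
  shows "Poly_Mapping.lookup (q * var_power i l) (m + Poly_Mapping.single i k) = 0"
proof (rule ccontr)
  assume "Poly_Mapping.lookup (q * var_power i l) (m + Poly_Mapping.single i k) \<noteq> 0"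
  hence "m + Poly_Mapping.single i k \<in> Poly_Mapping.keys (q * var_power i l)"
    by (simp add: in_keys_iff)
  then obtain n where n: "n \<in> Poly_Mapping.keys q"
    "m + Poly_Mapping.single i k = n + Poly_Mapping.single i l"
    using keys_mult[of q "var_power i l"] by auto
  have "Poly_Mapping.lookup m i = 0" "Poly_Mapping.lookup n i = 0"
    using assms n(1) by (auto simp: mpoly_vars_def in_keys_iff)
  thus False
    using \<open>k \<noteq> l\<close> arg_cong[OF n(2), of "\<lambda>m. Poly_Mapping.lookup m i"] by (simp add: lookup_add)
qed

lemma sum_mult_var_power_eq_0D:
  assumes zero: "(\<Sum>l\<in>K. q l * var_power i l) = 0"
    and vars: "\<And>l. l \<in> K \<Longrightarrow> i \<notin> mpoly_vars (q l)" and K: "finite K" "k \<in> K"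
  shows "q k = 0"
proof (rule poly_mapping_eqI, rule ccontr)
  fix m assume "Poly_Mapping.lookup (q k) m \<noteq> Poly_Mapping.lookup 0 m"
  hence m: "m \<in> Poly_Mapping.keys (q k)" by (simp add: in_keys_iff)
  hence "i \<notin> Poly_Mapping.keys m" using vars K(2) by (auto simp: mpoly_vars_def)
  have "0 = Poly_Mapping.lookup (\<Sum>l\<in>K. q l * var_power i l) (m + Poly_Mapping.single i k)"
    using zero by simp
  also have "\<dots> = (\<Sum>l\<in>K. if l = k then Poly_Mapping.lookup (q k) m else 0)"
    unfolding lookup_sum
    using vars \<open>i \<notin> Poly_Mapping.keys m\<close>
    by (intro sum.cong refl) (auto simp: lookup_mult_single_add intro!: lookup_mult_var_power_neq)
  also have "\<dots> = Poly_Mapping.lookup (q k) m"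
    using K by simp
  finally show False using m by (simp add: in_keys_iff)
qed

lemma alg_indep_Q_notin_acl:
  assumes indep: "alg_indep_Q I x" and i: "i \<in> I"
  shows "x i \<notin> acl (x ` (I - {i}))"
proof
  assume "x i \<in> acl (x ` (I - {i}))"
  then obtain p where p: "p \<noteq> 0" "\<And>k. coeff p k \<in> mpoly_values x (I - {i})" "poly p (x i) = 0"
    using acl_subringE[OF is_subring_mpoly_values image_subset_mpoly_values] by blast
  obtain q where q: "\<And>k. mpoly_vars (q k) \<subseteq> I - {i}" "\<And>k. coeff p k = mpoly_eval (q k) x"
    using p(2) unfolding mpoly_values_def by simp metis
  define P where "P = (\<Sum>k\<le>degree p. q k * var_power i k)"
  have "mpoly_vars (q k * var_power i k) \<subseteq> I" for k
    using q(1)[of k] i mpoly_vars_mult[of "q k" "var_power i k"]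
      mpoly_vars_single[of "Poly_Mapping.single i k" 1] by (auto split: if_splits)
  hence "mpoly_vars P \<subseteq> I"
    unfolding P_def
    using mpoly_vars_sum[of "\<lambda>k. q k * var_power i k" "{..degree p}"] by blast
  moreover have "mpoly_eval P x = poly p (x i)"
    by (simp add: P_def mpoly_eval_sum mpoly_eval_mult mpoly_eval_single mono_eval_single
        q(2) poly_altdef)
  ultimately have "(\<Sum>k\<le>degree p. q k * var_power i k) = 0"
    using indep p(3) unfolding alg_indep_Q_def P_def by simp
  hence "q (degree p) = 0"
    by (rule sum_mult_var_power_eq_0D) (use q(1) in auto)
  thus False
    using p(1) q(2)[of "degree p"] by (simp add: mpoly_eval_0)
qed

lemma alg_indep_Q_inj_on:
  assumes "alg_indep_Q I x"
  shows "inj_on x I"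
proof (rule inj_onI, rule ccontr)
  fix i j assume ij: "i \<in> I" "j \<in> I" "x i = x j" "i \<noteq> j"
  hence "x i \<in> x ` (I - {i})" by auto
  thus False
    using alg_indep_Q_notin_acl[OF assms ij(1)] subset_acl[of "x ` (I - {i})"] by auto
qed

lemma alg_indep_Q_indep:
  assumes "alg_indep_Q I x"
  shows "acl.indep (x ` I)"
  unfolding acl.indep_def
proof
  fix a assume "a \<in> x ` I"
  then obtain i where i: "i \<in> I" "a = x i" by blast
  have "x ` I - {a} = x ` (I - {i})"
    using alg_indep_Q_inj_on[OF assms] i by (auto simp: inj_on_def)
  thus "a \<notin> acl (x ` I - {a})"
    using alg_indep_Q_notin_acl[OF assms i(1)] i(2) by simp
qed

lemma alg_indep_Q_card_le:
  assumes "alg_indep_Q I x" "finite I" "finite T" "x ` I \<subseteq> acl T"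
  shows "card I \<le> card T"
  using acl.indep_card_le[OF _ assms(3) alg_indep_Q_indep[OF assms(1)] assms(4)] assms(2)
  by (simp add: card_image alg_indep_Q_inj_on[OF assms(1)])

subsection \<open>The Schanuel conjecture for finite sets\<close>

abbreviation rat_scale :: "rat \<Rightarrow> complex \<Rightarrow> complex" where
  "rat_scale r x \<equiv> of_rat r * x"

interpretation rat_vs: vector_space rat_scale
  by unfold_locales (auto simp: algebra_simps of_rat_add of_rat_mult)

lemma rat_independent_mult_image:
  assumes "rat_vs.independent A" "l \<noteq> 0"
  shows "rat_vs.independent ((\<lambda>x. x * l) ` A)"
proof -
  interpret pair: vector_space_pair rat_scale rat_scale
    by unfold_locales
  have "Vector_Spaces.linear rat_scale rat_scale (\<lambda>x. x * l)"
    by unfold_locales (auto simp: algebra_simps)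
  thus ?thesis
    using assms by (intro pair.linear_independent_injective_image) (auto simp: inj_on_def)
qed

lemma lin_indep_Q_if_rat_independent:
  assumes inj: "inj_on z {..<n}" and indep: "rat_vs.independent (z ` {..<n})"
  shows "lin_indep_Q n z"
  unfolding lin_indep_Q_def
proof (intro allI impI)
  fix c :: "nat \<Rightarrow> rat" and i
  assume zero: "(\<Sum>i<n. of_rat (c i) * z i) = 0" and i: "i < n"
  define g where "g = the_inv_into {..<n} z"
  have g: "g (z j) = j" if "j < n" for j
    using inj that by (simp add: g_def the_inv_into_f_f)
  have "(\<Sum>x\<in>z ` {..<n}. of_rat (c (g x)) * x) = (\<Sum>i<n. of_rat (c i) * z i)"
    by (simp add: sum.reindex[OF inj] g)
  hence "c (g (z i)) = 0"
    using rat_vs.independentD[OF indep _ order_refl, of "c \<circ> g" "z i"] zero i by simp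
  thus "c i = 0" using g i by simp
qed

lemma schanuel_card_le:
  assumes schanuel: "schanuel_conjecture"
    and Z: "finite Z" "rat_vs.independent Z" and T: "finite T" "Z \<union> exp ` Z \<subseteq> acl T"
  shows "card Z \<le> card T"
proof -
  define n where "n = card Z"
  obtain z where z: "bij_betw z {..<n} Z"
    using ex_bij_betw_nat_finite[OF Z(1)] by (auto simp: n_def atLeast0LessThan)
  define x where "x i = (if i < n then z i else exp (z (i - n)))" for i
  have "lin_indep_Q n z"
    using z Z(2) by (intro lin_indep_Q_if_rat_independent) (auto simp: bij_betw_def)
  then obtain I where I: "I \<subseteq> {..<2 * n}" "card I \<ge> n" "alg_indep_Q I x"
    using schanuel unfolding schanuel_conjecture_def x_def by blast
  have "x i \<in> Z \<union> exp ` Z" if "i < 2 * n" for i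
    using bij_betwE[OF z] that by (auto simp: x_def)
  hence "x ` I \<subseteq> acl T"
    using I(1) T(2) by blast
  hence "card I \<le> card T"
    using I T(1) by (intro alg_indep_Q_card_le) (auto intro: finite_subset)
  thus ?thesis using I(2) by (simp add: n_def)
qed

subsection \<open>Fields closed under exponentials and logarithms\<close>

definition exp_log_closed :: "complex \<Rightarrow> complex set \<Rightarrow> bool" where
  "exp_log_closed l K \<longleftrightarrow> alg_closed_subfield K \<and> (\<forall>w. w \<in> K \<longleftrightarrow> bpow l w \<in> K)"

lemma EL_level_Suc:
  "EL_level l (Suc n) = acl (EL_level l n \<union> bpow l ` EL_level l n \<union> Logb l (EL_level l n))"
  by (simp add: acl_def)

lemma EL_level_Suc_supset:
  "EL_level l n \<union> bpow l ` EL_level l n \<union> Logb l (EL_level l n) \<subseteq> EL_level l (Suc n)"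
  unfolding EL_level_Suc by (rule subset_acl)

lemma EL_eq_Union_Suc: "EL l = \<Union>(range (\<lambda>n. EL_level l (Suc n)))"
  unfolding EL_def using EL_level_Suc_supset by blast

lemma EL_least:
  assumes K: "exp_log_closed l K"
  shows "EL l \<subseteq> K"
proof -
  have "EL_level l n \<subseteq> K" for n
  proof (induction n)
    case 0
    have "is_subfield K"
      using K by (simp add: exp_log_closed_def subfield_if_alg_closed)
    thus ?case by (auto elim!: Rats_cases intro: subfield_of_rat)
  next
    case (Suc n)
    hence "EL_level l n \<union> bpow l ` EL_level l n \<union> Logb l (EL_level l n) \<subseteq> K"
      using K by (auto simp: exp_log_closed_def Logb_def)
    thus ?case
      unfolding EL_level_Suc using K by (intro acl_least) (simp add: exp_log_closed_def)
  qed
  thus ?thesis unfolding EL_def by blast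
qed

lemma exp_log_closed_EL: "exp_log_closed l (EL l)"
  unfolding exp_log_closed_def
proof (intro conjI allI iffI)
  have "incseq (\<lambda>n. EL_level l (Suc n))"
    using EL_level_Suc_supset by (intro incseq_SucI) blast
  hence "EL_level l (Suc m) \<union> EL_level l (Suc n) \<subseteq> EL_level l (Suc (max m n))" for m n
    by (meson Un_least incseqD max.cobounded1 max.cobounded2)
  hence "\<exists>M\<in>range (\<lambda>n. EL_level l (Suc n)). K \<union> L \<subseteq> M"
    if "K \<in> range (\<lambda>n. EL_level l (Suc n))" "L \<in> range (\<lambda>n. EL_level l (Suc n))" for K L
    using that by blast
  thus "alg_closed_subfield (EL l)"
    unfolding EL_eq_Union_Suc
    by (intro alg_closed_subfield_directed_Union)
      (auto simp: EL_level_Suc simp del: EL_level.simps intro: alg_closed_acl)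
next
  show "bpow l w \<in> EL l" if "w \<in> EL l" for w
    using that EL_level_Suc_supset unfolding EL_def by blast
  show "w \<in> EL l" if "bpow l w \<in> EL l" for w
    using that EL_level_Suc_supset[of l] unfolding EL_def Logb_def by blast
qed

subsection \<open>Towers of exponentials and logarithms\<close>

definition el_hull :: "complex \<Rightarrow> complex set \<Rightarrow> complex set" where
  "el_hull l A = acl (A \<union> bpow l ` A)"

inductive el_tower :: "complex \<Rightarrow> complex set \<Rightarrow> bool" for l where
  base: "el_tower l {1}"
| step: "el_tower l A \<Longrightarrow> w \<in> el_hull l A \<or> bpow l w \<in> el_hull l A \<Longrightarrow> el_tower l (insert w A)"

lemma el_hull_mono: "A \<subseteq> B \<Longrightarrow> el_hull l A \<subseteq> el_hull l B"
  unfolding el_hull_def by (intro acl_mono) auto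

lemma el_hull_insert: "{w, bpow l w} \<subseteq> el_hull l (insert w A)"
  using subset_acl[of "insert w A \<union> bpow l ` insert w A"] unfolding el_hull_def by auto

lemma el_tower_Un:
  assumes "el_tower l A" "el_tower l B"
  shows "el_tower l (A \<union> B)"
  using assms(2)
proof induction
  case base
  have "1 \<in> A" using assms(1) by induction auto
  thus ?case using assms(1) by (simp add: insert_absorb)
next
  case (step B w)
  thus ?case
    using el_hull_mono[of B "A \<union> B" l] el_tower.step[of l "A \<union> B" w] by auto
qed

lemma exp_log_closed_Union_el_hull: "exp_log_closed l (\<Union>(el_hull l ` Collect (el_tower l)))"
  (is "exp_log_closed l (\<Union>?\<F>)")
  unfolding exp_log_closed_def
proof (intro conjI allI)
  show "alg_closed_subfield (\<Union>?\<F>)"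
  proof (rule alg_closed_subfield_directed_Union)
    show "alg_closed_subfield K" if "K \<in> ?\<F>" for K
      using that alg_closed_acl by (auto simp: el_hull_def)
    show "?\<F> \<noteq> {}"
      using el_tower.base by blast
    fix K L assume "K \<in> ?\<F>" "L \<in> ?\<F>"
    then obtain A B where AB: "el_tower l A" "K = el_hull l A" "el_tower l B" "L = el_hull l B"
      by blast
    hence "K \<union> L \<subseteq> el_hull l (A \<union> B)"
      using el_hull_mono[of A "A \<union> B" l] el_hull_mono[of B "A \<union> B" l] by auto
    thus "\<exists>M\<in>?\<F>. K \<union> L \<subseteq> M"
      using el_tower_Un[OF AB(1,3)] by blast
  qed
  show "w \<in> \<Union>?\<F> \<longleftrightarrow> bpow l w \<in> \<Union>?\<F>" for w
  proof -
    have "{w, bpow l w} \<subseteq> \<Union>?\<F>" if "w \<in> \<Union>?\<F> \<or> bpow l w \<in> \<Union>?\<F>"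
    proof -
      obtain A where "el_tower l A" "w \<in> el_hull l A \<or> bpow l w \<in> el_hull l A"
        using \<open>w \<in> \<Union>?\<F> \<or> bpow l w \<in> \<Union>?\<F>\<close> by auto
      hence "el_tower l (insert w A)" by (rule el_tower.step)
      thus ?thesis using el_hull_insert[of w l A] by blast
    qed
    thus ?thesis by blast
  qed
qed

lemma bpow_0: "bpow l 0 = 1"
  by (simp add: bpow_def)

lemma bpow_add: "bpow l (x + y) = bpow l x * bpow l y"
  by (simp add: bpow_def distrib_right exp_add)

lemma bpow_of_int_mult: "bpow l (of_int n * x) = bpow l x powi n"
  by (simp add: bpow_def exp_power_int mult.assoc)

lemma alg_closed_bpow_of_rat_mult:
  assumes K: "alg_closed_subfield K" and x: "bpow l x \<in> K"
  shows "bpow l (of_rat r * x) \<in> K"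
proof -
  obtain p q where pq: "r = Rat.Fract p q" "q > 0" by (cases r) auto
  have "bpow l (of_rat r * x) ^ nat q = bpow l (of_int q * (of_rat r * x))"
    using pq(2) by (simp add: bpow_of_int_mult power_int_def)
  also have "of_int q * (of_rat r * x) = of_int p * x"
    using pq by (simp add: of_rat_rat)
  finally have "bpow l (of_rat r * x) ^ nat q \<in> K"
    using subfield_power_int[OF subfield_if_alg_closed[OF K] x] by (simp add: bpow_of_int_mult)
  thus ?thesis
    using pq(2) by (intro alg_closed_nth_root[OF K, of "nat q" "bpow l (of_rat r * x)"]) auto
qed

lemma alg_closed_rat_span:
  assumes K: "alg_closed_subfield K" and "A \<union> bpow l ` A \<subseteq> K" and "w \<in> rat_vs.span A"
  shows "w \<in> K" "bpow l w \<in> K"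
proof -
  have F: "is_subfield K" and R: "is_subring K"
    using K by (auto intro: subfield_if_alg_closed subring_if_alg_closed)
  have "rat_vs.subspace {w. w \<in> K \<and> bpow l w \<in> K}"
    by (rule rat_vs.subspaceI)
      (auto simp: bpow_0 bpow_add alg_closed_bpow_of_rat_mult[OF K]
        subring_0[OF R] subring_1[OF R] subring_add[OF R] subring_mult[OF R] subfield_of_rat[OF F])
  hence "rat_vs.span A \<subseteq> {w. w \<in> K \<and> bpow l w \<in> K}"
    using assms(2) by (intro rat_vs.span_minimal) auto
  thus "w \<in> K" "bpow l w \<in> K" using assms(3) by auto
qed

text \<open>
  The field generated by \<open>A\<close> and its exponentials has transcendence degree less than the dimension
  of the rational span of \<open>A\<close>.
\<close>

definition rank_deficient :: "complex \<Rightarrow> complex set \<Rightarrow> bool" where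
  "rank_deficient l A \<longleftrightarrow> (\<exists>Z T. Z \<subseteq> A \<and> finite Z \<and> rat_vs.independent Z \<and>
     finite T \<and> card T < card Z \<and> A \<union> bpow l ` A \<subseteq> acl T)"

lemma rank_deficientE:
  assumes "rank_deficient l A"
  obtains Z T where "Z \<subseteq> A" "finite Z" "rat_vs.independent Z" "finite T" "card T < card Z"
    "A \<union> bpow l ` A \<subseteq> acl T"
  using assms unfolding rank_deficient_def by blast

lemma rank_deficient_insert:
  assumes "rank_deficient l A" and w: "w \<in> el_hull l A \<or> bpow l w \<in> el_hull l A"
  shows "rank_deficient l (insert w A)"
proof -
  obtain Z T where Z: "Z \<subseteq> A" "finite Z" "rat_vs.independent Z"
    and T: "finite T" "card T < card Z" "A \<union> bpow l ` A \<subseteq> acl T"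
    using assms(1) by (rule rank_deficientE)
  show ?thesis
  proof (cases "w \<in> rat_vs.span Z")
    case True
    have "Z \<union> bpow l ` Z \<subseteq> acl T"
      using Z(1) T(3) by blast
    hence "w \<in> acl T" "bpow l w \<in> acl T"
      using alg_closed_rat_span[OF alg_closed_acl _ True] by auto
    thus ?thesis
      unfolding rank_deficient_def using Z T by (intro exI[of _ Z] exI[of _ T]) auto
  next
    case False
    define t where "t = (if w \<in> el_hull l A then bpow l w else w)"
    have "el_hull l A \<subseteq> acl T"
      unfolding el_hull_def using T(3) by (intro acl_least alg_closed_acl)
    hence "{w, bpow l w} \<subseteq> insert t (acl T)"
      using w by (auto simp: t_def)
    moreover have "insert t (acl T) \<subseteq> acl (insert t T)"
      using acl_mono[of T "insert t T"] subset_acl[of "insert t T"] by auto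
    ultimately have "insert w A \<union> bpow l ` insert w A \<subseteq> acl (insert t T)"
      using T(3) by auto
    moreover have "rat_vs.independent (insert w Z)"
      using Z(3) False by (simp add: rat_vs.independent_insertI)
    moreover have "w \<notin> Z" using False rat_vs.span_base by auto
    hence "card (insert t T) < card (insert w Z)"
      using T(1,2) Z(2) by (simp add: card_insert_if)
    ultimately show ?thesis
      unfolding rank_deficient_def
      using Z T by (intro exI[of _ "insert w Z"] exI[of _ "insert t T"]) auto
  qed
qed

lemma el_tower_rank_deficient:
  assumes "el_tower l A" and l: "algebraic (exp l)"
  shows "rank_deficient l A"
  using assms(1)
proof induction
  case base
  have "{1} \<union> bpow l ` {1} \<subseteq> acl {}"
    using alg_closed_contains_algebraic[OF alg_closed_acl] l by (auto simp: bpow_def)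
  thus ?case
    unfolding rank_deficient_def by (intro exI[of _ "{1}"] exI[of _ "{}"]) auto
next
  case (step A w)
  thus ?case by (intro rank_deficient_insert)
qed

lemma schanuel_notin_el_hull:
  assumes schanuel: "schanuel_conjecture" and l: "l \<noteq> 0" and "rank_deficient l A"
  shows "l \<notin> el_hull l A"
proof
  assume "l \<in> el_hull l A"
  obtain Z T where Z: "Z \<subseteq> A" "finite Z" "rat_vs.independent Z"
    and T: "finite T" "card T < card Z" "A \<union> bpow l ` A \<subseteq> acl T"
    using \<open>rank_deficient l A\<close> by (rule rank_deficientE)
  define lZ where "lZ = (\<lambda>z. z * l) ` Z"
  have "l \<in> acl T"
    using \<open>l \<in> el_hull l A\<close> acl_least[OF alg_closed_acl T(3)] unfolding el_hull_def by blast
  hence "lZ \<subseteq> acl T"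
    using Z(1) T(3) by (auto simp: lZ_def intro!: subring_mult subring_if_alg_closed alg_closed_acl)
  moreover have "exp ` lZ = bpow l ` Z"
    by (simp add: lZ_def image_image bpow_def)
  ultimately have "lZ \<union> exp ` lZ \<subseteq> acl T"
    using Z(1) T(3) by blast
  hence "card lZ \<le> card T"
    using Z(2,3) T(1) l unfolding lZ_def
    by (intro schanuel_card_le schanuel rat_independent_mult_image) auto
  moreover have "card lZ = card Z"
    unfolding lZ_def using l by (intro card_image) (auto simp: inj_on_def)
  ultimately show False using T(2) by simp
qed

lemma schanuel_notin_EL:
  assumes schanuel: "schanuel_conjecture" and l: "l \<noteq> 0" "algebraic (exp l)"
  shows "l \<notin> EL l"
proof
  assume "l \<in> EL l"
  then obtain A where "el_tower l A" "l \<in> el_hull l A"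
    using EL_least[OF exp_log_closed_Union_el_hull] by blast
  thus False
    using schanuel_notin_el_hull[OF schanuel l(1) el_tower_rank_deficient[OF _ l(2)]] by blast
qed

lemma schanuel_log_notin_EL:
  assumes schanuel: "schanuel_conjecture" and l: "l \<noteq> 0" "algebraic (exp l)"
    and L: "L \<noteq> 0" "exp L \<in> EL l"
  shows "L \<notin> EL l"
proof
  assume "L \<in> EL l"
  have "bpow l (L / l) = exp L"
    using l(1) by (simp add: bpow_def)
  hence "L / l \<in> EL l"
    using L(2) exp_log_closed_EL unfolding exp_log_closed_def by metis
  moreover have "is_subfield (EL l)"
    using exp_log_closed_EL by (simp add: exp_log_closed_def subfield_if_alg_closed)
  ultimately have "L / (L / l) \<in> EL l"
    using subfield_divide[OF _ \<open>L \<in> EL l\<close>] by blast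
  thus False
    using schanuel_notin_EL[OF schanuel l] L(1) by simp
qed

theorem theorem11p5:
  assumes "schanuel_conjecture"
  shows "(\<forall>b L. algebraic b \<and> b \<noteq> 0 \<and> b \<noteq> 1 \<and> L \<noteq> 0 \<and> exp L = b \<longrightarrow> L \<notin> EL_alg)
       \<and> complex_of_real pi \<notin> EL_alg
       \<and> exp (1::complex) \<notin> EL_alg
       \<and> (\<forall>a\<in>EL_alg - {0, 1}. \<forall>L. exp L = a \<longrightarrow> L \<notin> EL_alg)"
proof -
  have closed: "alg_closed_subfield EL_alg"
    using exp_log_closed_EL unfolding EL_alg_def exp_log_closed_def by blast
  note algebraic = alg_closed_contains_algebraic[OF closed]
  have log: "L \<notin> EL_alg" if "exp L \<in> EL_alg" "L \<noteq> 0" for L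
    using schanuel_log_notin_EL[OF assms, of "\<i> * complex_of_real pi" L] that
    by (simp add: EL_alg_def)
  have "\<i> * complex_of_real pi \<notin> EL_alg"
    by (intro log algebraic) simp_all
  hence "complex_of_real pi \<notin> EL_alg"
    using subring_mult[OF subring_if_alg_closed[OF closed], of \<i>] algebraic[of \<i>] by auto
  moreover have "exp (1::complex) \<notin> EL_alg"
    using log[of 1] algebraic[of 1] by auto
  moreover have "L \<noteq> 0" if "exp L \<noteq> 1" for L :: complex
    using that by auto
  ultimately show ?thesis
    using log algebraic by blast
qed

end
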